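(* Let $V$ be a finite set of Boolean variables and let $\psi$ be a DQBF over $V$ in negation normal form (as defined in the context). Then the set $[\![\psi]\!]$ of Skolem functions of $\psi$ satisfies the following recursive characterization: (a) For $v\in V$: $[\![v]\!]=\{s\in\mathcal{S}_{v}\mid s(v)=\mathbf{1}\}$. (b) For $v\in V$: $[\![\neg v]\!]=\{s\in\mathcal{S}_{\neg v}\mid s(v)=\mathbf{0}\}$. (c) $[\![(\varphi_1\wedge\varphi_2)]\!]=\{s\in\mathcal{S}_{\varphi_1\wedge\varphi_2}\mid s|_{V^{\mathrm{free}}_{\varphi_1}\cup V^{\exists}_{\varphi_1}}\in[\![\varphi_1]\!]\ \text{and}\ s|_{V^{\mathrm{free}}_{\varphi_2}\cup V^{\exists}_{\varphi_2}}\in[\![\varphi_2]\!]\}$. (d) $[\![(\varphi_1\vee\varphi_2)]\!]=\{s\in\mathcal{S}_{\varphi_1\vee\varphi_2}\mid s|_{V^{\mathrm{free}}_{\varphi_1}\cup V^{\exists}_{\varphi_1}}\in[\![\varphi_1]\!]\ \text{or}\ s|_{V^{\mathrm{free}}_{\varphi_2}\cup V^{\exists}_{\varphi_2}}\in[\![\varphi_2]\!]\}$. (e) $[\![\exists v(D_v):\varphi^{-v}]\!]=[\![\varphi^{-v}]\!]$. (f) $[\![\forall v:\varphi]\!]$ is the set of all $t\in\mathcal{S}_{\forall v:\varphi}$ for which there exist $s_0,s_1\in[\![\varphi]\!]$ with $s_0(v)=\mathbf{0}$, $s_1(v)=\mathbf{1}$, such that $t(w)=s_0(w)=s_1(w)$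 for all $w\in V^{\mathrm{free}}_{\forall v:\varphi}$, $t(w)=s_0(w)=s_1(w)$ for all $w\in V^{\exists}_{\forall v:\varphi}$ with $v\notin D_w$, and $t(w)=\mathrm{ITE}(v,s_1(w),s_0(w))$ for all $w\in V^{\exists}_{\forall v:\varphi}$ with $v\in D_w$.
   Context: Notation: for a set $W$ of Boolean variables, $\mathcal{A}(W)$ is the set of assignments $W\to\{0,1\}$; $\mathcal{F}(W)$ is the set of Boolean functions $\mathcal{A}(W)\to\{0,1\}$; the support $\mathrm{supp}(f)$ of $f\in\mathcal{F}(W)$ is the set of variables on which $f$ actually depends; $\mathbf{0},\mathbf{1}$ are the constant functions; $\mathrm{ITE}(f,g,h)=(f\wedge g)\vee(\neg f\wedge h)$; $s|_W$ denotes the restriction of a map $s$ to $W$. A formula $\varphi$ is a tautology ($\vDash\varphi$) if it evaluates to 1 under all assignments. Syntax (non-closed non-prenex DQBFs in NNF over a finite variable set $V$). The set $\mathcal{D}$ of such formulas, together with for each $\psi$ the set $V^{\exists}_\psi$ of existential variables, $V^{\forall}_\psi$ of universal variables, $V^{\mathrm{fs}}_\psi$ of free variables occurring in $\psi$, and a dependency set $D_y\subseteq V$ for each existential variable $y$, is the smallest set closed under the rules: (1) for $v\in V$, $v\in\mathcal{D}$ with $V^\exists=V^\forall=\emptyset$, $V^{\mathrm{fs}}=\{v\}$; (2) for $v\in V$, $\neg v\in\mathcal{D}$, same sets; (3),(4) if $\varphi_1,\varphi_2\in\mathcal{D}$ and $\bigl(V^Q_{\varphi_1}\cup V^{\mathrm{fs}}_{\varphi_1}\cup\bigcup_{y\in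 V^\exists_{\varphi_1}}D_y\bigr)\cap V^Q_{\varphi_2}=\emptyset$ and $\bigl(V^Q_{\varphi_2}\cup V^{\mathrm{fs}}_{\varphi_2}\cup\bigcup_{y\in V^\exists_{\varphi_2}}D_y\bigr)\cap V^Q_{\varphi_1}=\emptyset$, then $(\varphi_1\wedge\varphi_2)$ and $(\varphi_1\vee\varphi_2)$ are in $\mathcal{D}$, with $V^\exists$ and $V^\forall$ the (disjoint) unions and $V^{\mathrm{fs}}$ the union of those of $\varphi_1,\varphi_2$; (5) if $\varphi\in\mathcal{D}$, $v\in V^{\mathrm{free}}_\varphi$ and $D_v\subseteq V\setminus(V^Q_\varphi\cup\{v\})$, then $\exists v(D_v):\varphi^{-v}\in\mathcal{D}$, where $\varphi^{-v}$ is $\varphi$ with $v$ removed from the dependency sets of all existential variables of $\varphi$; it has $V^\exists=V^\exists_\varphi\cup\{v\}$, $V^\forall=V^\forall_\varphi$, $V^{\mathrm{fs}}=V^{\mathrm{fs}}_\varphi\setminus\{v\}$; (6) if $\varphi\in\mathcal{D}$ and $v\in V^{\mathrm{free}}_\varphi$, then $\forall v:\varphi\in\mathcal{D}$ with $V^\exists=V^\exists_\varphi$, $V^\forall=V^\forall_\varphi\cup\{v\}$, $V^{\mathrm{fs}}=V^{\mathrm{fs}}_\varphi\setminus\{v\}$. Here $V^Q_\psi=V^\exists_\psi\cup V^\forall_\psi$, $V_\psi=V^Q_\psi\cup V^{\mathrm{fs}}_\psi$ (variables occurring in $\psi$), and $V^{\mathrm{free}}_\psi=V\setminus V^Q_\psi$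 (free variables). Semantics. A Skolem function candidate for $\psi\in\mathcal{D}$ is a map $s:V^{\mathrm{free}}_\psi\cup V^\exists_\psi\to\mathcal{F}(V^\forall_\psi)$ with $s(v)\in\{\mathbf{0},\mathbf{1}\}$ for $v\in V^{\mathrm{free}}_\psi$ and $\mathrm{supp}(s(v))\subseteq D_v\cap V^\forall_\psi$ for $v\in V^\exists_\psi$; $\mathcal{S}_\psi$ is the set of all of them. $s(\psi)$ denotes the quantifier-free formula obtained from $\psi$ by replacing every variable $v$ in the domain of $s$ by $s(v)$ and deleting all quantifiers. The semantics is $[\![\psi]\!]=\{s\in\mathcal{S}_\psi\mid\ \vDash s(\psi)\}$; its elements are the Skolem functions of $\psi$, and $\psi$ is satisfiable iff $[\![\psi]\!]\neq\emptyset$.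
   Formalization: In (c) and (d), the free variables, the restriction of s and the Skolem functions of φ1 are taken over V without the quantified variables of φ2 (and symmetrically for φ2), since s is undefined on the universal variables of the other subformula and the literal claim fails. *)

theory Defs
  imports Main
begin

text \<open>
  Boolean functions take total assignments, and \<open>bfuns W\<close> consists of those that only look at \<open>W\<close>.
  Hence \<open>bfuns W \<subseteq> bfuns W'\<close> for \<open>W \<subseteq> W'\<close>; this is the usual identification of a function of the
  variables \<open>W\<close> with the function of the variables \<open>W'\<close> that ignores \<open>W' - W\<close>, and it is what gives
  sense to comparing values of Skolem functions of different formulas.
\<close>

type_synonym 'v bfun = "('v \<Rightarrow> bool) \<Rightarrow> bool"

definition bfuns :: "'v set \<Rightarrow> 'v bfun set" where
  "bfuns W = {f. \<forall>a b. (\<forall>w\<in>W. a w = b w) \<longrightarrow> f a = f b}"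

definition supp :: "'v bfun \<Rightarrow> 'v set" where
  "supp f = {v. \<exists>a. f (a(v := True)) \<noteq> f (a(v := False))}"

definition bzero :: "'v bfun" where
  "bzero = (\<lambda>_. False)"

definition bone :: "'v bfun" where
  "bone = (\<lambda>_. True)"

definition bvar :: "'v \<Rightarrow> 'v bfun" where
  "bvar v = (\<lambda>a. a v)"

definition ITE :: "'v bfun \<Rightarrow> 'v bfun \<Rightarrow> 'v bfun \<Rightarrow> 'v bfun" where
  "ITE f g h = (\<lambda>a. (f a \<and> g a) \<or> (\<not> f a \<and> h a))"


text \<open>Raw formulas; \<open>Exists v D \<phi>\<close> carries the dependency set \<open>D\<close> of \<open>v\<close>.\<close>

datatype 'v dqbf =
    Pos 'v
  | Neg 'v
  | Conj "'v dqbf" "'v dqbf"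
  | Disj "'v dqbf" "'v dqbf"
  | Exists 'v "'v set" "'v dqbf"
  | Forall 'v "'v dqbf"

primrec Vex :: "'v dqbf \<Rightarrow> 'v set" where
  "Vex (Pos v) = {}"
| "Vex (Neg v) = {}"
| "Vex (Conj \<phi>1 \<phi>2) = Vex \<phi>1 \<union> Vex \<phi>2"
| "Vex (Disj \<phi>1 \<phi>2) = Vex \<phi>1 \<union> Vex \<phi>2"
| "Vex (Exists v D \<phi>) = Vex \<phi> \<union> {v}"
| "Vex (Forall v \<phi>) = Vex \<phi>"

primrec Vall :: "'v dqbf \<Rightarrow> 'v set" where
  "Vall (Pos v) = {}"
| "Vall (Neg v) = {}"
| "Vall (Conj \<phi>1 \<phi>2) = Vall \<phi>1 \<union> Vall \<phi>2"
| "Vall (Disj \<phi>1 \<phi>2) = Vall \<phi>1 \<union> Vall \<phi>2"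
| "Vall (Exists v D \<phi>) = Vall \<phi>"
| "Vall (Forall v \<phi>) = Vall \<phi> \<union> {v}"

primrec Vfs :: "'v dqbf \<Rightarrow> 'v set" where
  "Vfs (Pos v) = {v}"
| "Vfs (Neg v) = {v}"
| "Vfs (Conj \<phi>1 \<phi>2) = Vfs \<phi>1 \<union> Vfs \<phi>2"
| "Vfs (Disj \<phi>1 \<phi>2) = Vfs \<phi>1 \<union> Vfs \<phi>2"
| "Vfs (Exists v D \<phi>) = Vfs \<phi> - {v}"
| "Vfs (Forall v \<phi>) = Vfs \<phi> - {v}"

definition VQ :: "'v dqbf \<Rightarrow> 'v set" where
  "VQ \<phi> = Vex \<phi> \<union> Vall \<phi>"

text \<open>
  Relative to the ambient variable set \<open>V\<close>: variables of \<open>V\<close> that do not occur in \<open>\<phi>\<close> are free.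
\<close>

definition Vfree :: "'v set \<Rightarrow> 'v dqbf \<Rightarrow> 'v set" where
  "Vfree V \<phi> = V - VQ \<phi>"

text \<open>
  The dependency set of \<open>y\<close> in a formula, empty if \<open>y\<close> is not existential in it. In a well-formed
  formula \<open>y\<close> is quantified at most once, so at most one of the two sets in the unions is nonempty.
\<close>

primrec dep :: "'v dqbf \<Rightarrow> 'v \<Rightarrow> 'v set" where
  "dep (Pos v) y = {}"
| "dep (Neg v) y = {}"
| "dep (Conj \<phi>1 \<phi>2) y = dep \<phi>1 y \<union> dep \<phi>2 y"
| "dep (Disj \<phi>1 \<phi>2) y = dep \<phi>1 y \<union> dep \<phi>2 y"
| "dep (Exists v D \<phi>) y = (if y = v then D else dep \<phi> y)"
| "dep (Forall v \<phi>) y = dep \<phi> y"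

text \<open>\<open>del_dep v\<close> removes \<open>v\<close> from all dependency sets; it is written \<open>\<phi>\<^sup>-\<^sup>v\<close> on paper.\<close>

primrec del_dep :: "'v \<Rightarrow> 'v dqbf \<Rightarrow> 'v dqbf" where
  "del_dep v (Pos x) = Pos x"
| "del_dep v (Neg x) = Neg x"
| "del_dep v (Conj \<phi>1 \<phi>2) = Conj (del_dep v \<phi>1) (del_dep v \<phi>2)"
| "del_dep v (Disj \<phi>1 \<phi>2) = Disj (del_dep v \<phi>1) (del_dep v \<phi>2)"
| "del_dep v (Exists y D \<phi>) = Exists y (D - {v}) (del_dep v \<phi>)"
| "del_dep v (Forall y \<phi>) = Forall y (del_dep v \<phi>)"

definition compatible :: "'v dqbf \<Rightarrow> 'v dqbf \<Rightarrow> bool" where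
  "compatible \<phi>1 \<phi>2 \<longleftrightarrow>
     (VQ \<phi>1 \<union> Vfs \<phi>1 \<union> (\<Union>y\<in>Vex \<phi>1. dep \<phi>1 y)) \<inter> VQ \<phi>2 = {} \<and>
     (VQ \<phi>2 \<union> Vfs \<phi>2 \<union> (\<Union>y\<in>Vex \<phi>2. dep \<phi>2 y)) \<inter> VQ \<phi>1 = {}"

inductive_set DQBF :: "'v set \<Rightarrow> 'v dqbf set" for V :: "'v set" where
  Pos: "v \<in> V \<Longrightarrow> Pos v \<in> DQBF V"
| Neg: "v \<in> V \<Longrightarrow> Neg v \<in> DQBF V"
| Conj: "\<phi>1 \<in> DQBF V \<Longrightarrow> \<phi>2 \<in> DQBF V \<Longrightarrow> compatible \<phi>1 \<phi>2 \<Longrightarrow> Conj \<phi>1 \<phi>2 \<in> DQBF V"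
| Disj: "\<phi>1 \<in> DQBF V \<Longrightarrow> \<phi>2 \<in> DQBF V \<Longrightarrow> compatible \<phi>1 \<phi>2 \<Longrightarrow> Disj \<phi>1 \<phi>2 \<in> DQBF V"
| Exists: "\<phi> \<in> DQBF V \<Longrightarrow> v \<in> Vfree V \<phi> \<Longrightarrow> D \<subseteq> V - (VQ \<phi> \<union> {v})
    \<Longrightarrow> Exists v D (del_dep v \<phi>) \<in> DQBF V"
| Forall: "\<phi> \<in> DQBF V \<Longrightarrow> v \<in> Vfree V \<phi> \<Longrightarrow> Forall v \<phi> \<in> DQBF V"


text \<open>Quantifier-free formulas in which Boolean functions may be plugged in as atoms.\<close>

datatype 'v qf =
    QVar 'v
  | QFun "'v bfun"
  | QNot "'v qf"
  | QAnd "'v qf" "'v qf"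
  | QOr "'v qf" "'v qf"

primrec qf_val :: "'v qf \<Rightarrow> ('v \<Rightarrow> bool) \<Rightarrow> bool" where
  "qf_val (QVar v) a = a v"
| "qf_val (QFun f) a = f a"
| "qf_val (QNot p) a = (\<not> qf_val p a)"
| "qf_val (QAnd p q) a = (qf_val p a \<and> qf_val q a)"
| "qf_val (QOr p q) a = (qf_val p a \<or> qf_val q a)"

definition tautology :: "'v qf \<Rightarrow> bool" where
  "tautology p \<longleftrightarrow> (\<forall>a. qf_val p a)"

text \<open>Skolem function candidates are partial maps, so that their domain and restriction are literal.\<close>

type_synonym 'v skolem = "'v \<rightharpoonup> 'v bfun"

definition subst_var :: "'v skolem \<Rightarrow> 'v \<Rightarrow> 'v qf" where
  "subst_var s v = (case s v of None \<Rightarrow> QVar v | Some f \<Rightarrow> QFun f)"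

primrec subst :: "'v skolem \<Rightarrow> 'v dqbf \<Rightarrow> 'v qf" where
  "subst s (Pos v) = subst_var s v"
| "subst s (Neg v) = QNot (subst_var s v)"
| "subst s (Conj \<phi>1 \<phi>2) = QAnd (subst s \<phi>1) (subst s \<phi>2)"
| "subst s (Disj \<phi>1 \<phi>2) = QOr (subst s \<phi>1) (subst s \<phi>2)"
| "subst s (Exists v D \<phi>) = subst s \<phi>"
| "subst s (Forall v \<phi>) = subst s \<phi>"

definition cand :: "'v set \<Rightarrow> 'v dqbf \<Rightarrow> 'v skolem set" where
  "cand V \<psi> = {s. dom s = Vfree V \<psi> \<union> Vex \<psi> \<and> ran s \<subseteq> bfuns (Vall \<psi>) \<and>
     (\<forall>v\<in>Vfree V \<psi>. the (s v) \<in> {bzero, bone}) \<and>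
     (\<forall>v\<in>Vex \<psi>. supp (the (s v)) \<subseteq> dep \<psi> v \<inter> Vall \<psi>)}"

definition sem :: "'v set \<Rightarrow> 'v dqbf \<Rightarrow> 'v skolem set" where
  "sem V \<psi> = {s \<in> cand V \<psi>. tautology (subst s \<psi>)}"

text \<open>
  Changing the ambient set: if no variable of \<open>X\<close> occurs in \<open>\<phi>\<close> or in one of its dependency sets,
  then \<open>\<phi>\<close> is also a formula over \<open>V - X\<close>, and its Skolem functions over \<open>V - X\<close> are exactly its
  Skolem functions over \<open>V\<close> without their (arbitrary constant) values on \<open>X\<close>. By \<^const>\<open>compatible\<close>,
  this applies to \<open>\<phi>1\<close> with \<open>X = VQ \<phi>2\<close> and vice versa when \<open>\<phi>1\<close> and \<open>\<phi>2\<close> are joined by a binary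
  connective \<open>\<circ>\<close>. A Skolem function of \<open>\<phi>1 \<circ> \<phi>2\<close> over \<open>V\<close> assigns no constants to \<open>VQ \<phi>2\<close>, so
  its restriction to the domain for \<open>\<phi>1\<close> must be taken over \<open>V - VQ \<phi>2\<close>.
\<close>

lemma Vex_del_dep [simp]: "Vex (del_dep v \<phi>) = Vex \<phi>"
  and Vall_del_dep [simp]: "Vall (del_dep v \<phi>) = Vall \<phi>"
  and Vfs_del_dep [simp]: "Vfs (del_dep v \<phi>) = Vfs \<phi>"
  and VQ_del_dep [simp]: "VQ (del_dep v \<phi>) = VQ \<phi>"
  and dep_del_dep [simp]: "dep (del_dep v \<phi>) y = dep \<phi> y - {v}"
  by (induction \<phi>) (auto simp: VQ_def)

lemma DQBF_vars:
  assumes "\<phi> \<in> DQBF V"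
  shows "VQ \<phi> \<subseteq> V" "Vfs \<phi> \<subseteq> V" "Vex \<phi> \<inter> Vall \<phi> = {}" "Vfs \<phi> \<inter> VQ \<phi> = {}"
proof -
  have "VQ \<phi> \<subseteq> V \<and> Vfs \<phi> \<subseteq> V \<and> Vex \<phi> \<inter> Vall \<phi> = {} \<and> Vfs \<phi> \<inter> VQ \<phi> = {}"
    using assms by induction (auto simp: VQ_def Vfree_def compatible_def)
  then show "VQ \<phi> \<subseteq> V" "Vfs \<phi> \<subseteq> V" "Vex \<phi> \<inter> Vall \<phi> = {}" "Vfs \<phi> \<inter> VQ \<phi> = {}"
    by auto
qed

lemma DQBF_ambient:
  assumes "\<phi> \<in> DQBF V" "(VQ \<phi> \<union> Vfs \<phi> \<union> (\<Union>y\<in>Vex \<phi>. dep \<phi> y)) \<inter> X = {}"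
  shows "\<phi> \<in> DQBF (V - X)"
  using assms
proof induction
  case (Exists \<phi> v D)
  have "v \<notin> Vex \<phi>" "v \<notin> X" using Exists by (auto simp: Vfree_def VQ_def)
  then have "(VQ \<phi> \<union> Vfs \<phi> \<union> (\<Union>y\<in>Vex \<phi>. dep \<phi> y)) \<inter> X = {}" "D \<inter> X = {}"
    using Exists.prems by (auto simp: VQ_def split: if_splits)
  then show ?case
    using Exists \<open>v \<notin> X\<close> by (intro DQBF.Exists) (auto simp: Vfree_def)
next
  case (Forall \<phi> v)
  then show ?case by (intro DQBF.Forall) (auto simp: Vfree_def VQ_def)
qed (auto simp: VQ_def intro!: DQBF.intros)

lemma subst_cong:
  assumes "\<And>v. v \<in> Vfs \<phi> \<union> VQ \<phi> \<Longrightarrow> qf_val (subst_var s v) a = qf_val (subst_var s' v) a'"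
  shows "qf_val (subst s \<phi>) a = qf_val (subst s' \<phi>) a'"
  using assms by (induction \<phi>) (auto simp: VQ_def)

lemma sem_ambient:
  assumes "\<phi> \<in> DQBF V" "(VQ \<phi> \<union> Vfs \<phi> \<union> (\<Union>y\<in>Vex \<phi>. dep \<phi> y)) \<inter> X = {}"
  shows "sem (V - X) \<phi> = (\<lambda>s. s |` (Vfree (V - X) \<phi> \<union> Vex \<phi>)) ` sem V \<phi>"
proof -
  let ?W = "Vfree (V - X) \<phi> \<union> Vex \<phi>"
  note vars = DQBF_vars[OF assms(1)]
  have disj: "VQ \<phi> \<inter> X = {}" "Vex \<phi> \<inter> X = {}" using assms(2) by (auto simp: VQ_def)
  have taut: "tautology (subst (s |` ?W) \<phi>) = tautology (subst s \<phi>)"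
    if s: "dom s = Vfree V \<phi> \<union> Vex \<phi>" for s
  proof -
    have "(s |` ?W) v = s v" if "v \<in> Vfs \<phi> \<union> VQ \<phi>" for v
    proof (cases "v \<in> ?W")
      case False
      then have "v \<notin> dom s"
        using that s vars assms(2) by (auto simp: Vfree_def VQ_def)
      then show ?thesis by (simp add: restrict_map_def domIff)
    qed simp
    then have "qf_val (subst (s |` ?W) \<phi>) a = qf_val (subst s \<phi>) a" for a
      by (intro subst_cong) (simp add: subst_var_def)
    then show ?thesis by (simp add: tautology_def)
  qed
  show ?thesis
  proof (intro equalityI subsetI)
    fix r assume r: "r \<in> sem (V - X) \<phi>"
    define s where "s = (\<lambda>w. if w \<in> V \<inter> X then Some bone else r w)"
    have domr: "dom r = ?W" using r by (auto simp: sem_def cand_def)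
    have doms: "dom s = Vfree V \<phi> \<union> Vex \<phi>"
    proof -
      have "dom s = dom r \<union> (V \<inter> X)" by (auto simp: s_def split: if_splits)
      then show ?thesis using domr disj by (auto simp: Vfree_def)
    qed
    have res: "s |` ?W = r"
    proof
      fix w
      show "(s |` ?W) w = r w"
      proof (cases "w \<in> ?W")
        case True
        then have "w \<notin> V \<inter> X" using disj by (auto simp: Vfree_def)
        then show ?thesis using True by (auto simp: s_def)
      next
        case False
        then have "w \<notin> dom r" by (simp add: domr)
        then show ?thesis using False by (simp add: restrict_map_def domIff)
      qed
    qed
    have "tautology (subst s \<phi>)"
      using taut[OF doms] r by (simp add: res sem_def)
    moreover have "ran s \<subseteq> bfuns (Vall \<phi>)"
    proof -
      have "ran r \<subseteq> bfuns (Vall \<phi>)" using r by (simp add: sem_def cand_def)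
      moreover have "bone \<in> bfuns (Vall \<phi>)" by (simp add: bone_def bfuns_def)
      moreover have "ran s \<subseteq> insert bone (ran r)" by (auto simp: s_def ran_def)
      ultimately show ?thesis by blast
    qed
    moreover have "the (s v) \<in> {bzero, bone}" if "v \<in> Vfree V \<phi>" for v
      using r that by (auto simp: s_def sem_def cand_def Vfree_def)
    moreover have "supp (the (s v)) \<subseteq> dep \<phi> v \<inter> Vall \<phi>" if "v \<in> Vex \<phi>" for v
    proof -
      have "s v = r v" using that disj by (auto simp: s_def)
      then show ?thesis using r that by (simp add: sem_def cand_def)
    qed
    ultimately have "s \<in> sem V \<phi>"
      using doms by (simp add: sem_def cand_def)
    then show "r \<in> (\<lambda>s. s |` ?W) ` sem V \<phi>" using res by blast
  next
    fix r assume "r \<in> (\<lambda>s. s |` ?W) ` sem V \<phi>"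
    then obtain s where s: "s \<in> sem V \<phi>" and r: "r = s |` ?W" by blast
    have doms: "dom s = Vfree V \<phi> \<union> Vex \<phi>" using s by (simp add: sem_def cand_def)
    have "dom r = ?W" using doms by (auto simp: r Vfree_def)
    moreover have "ran r \<subseteq> ran s" by (auto simp: r ran_def restrict_map_def split: if_splits)
    moreover have "\<forall>v\<in>?W. r v = s v" by (simp add: r)
    moreover have "tautology (subst r \<phi>)" using s taut[OF doms] by (simp add: r sem_def)
    moreover have "Vfree (V - X) \<phi> \<subseteq> Vfree V \<phi>" by (auto simp: Vfree_def)
    ultimately show "r \<in> sem (V - X) \<phi>"
      using s unfolding sem_def cand_def by auto
  qed
qed

end

theory Submission
  imports Defs
begin

text \<open>
  Since \<open>\<phi>1\<close> and \<open>\<phi>2\<close> are compatible, a candidate for \<open>\<phi>1 \<or> \<phi>2\<close> turns them into functions of the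
  disjoint sets \<open>Vall \<phi>1\<close> and \<open>Vall \<phi>2\<close>; falsifying assignments of the two disjuncts can therefore be
  glued together, and the disjunction is a tautology only if a disjunct is. An existential variable
  of \<open>\<exists>v(D): \<phi>\<close> may depend on no universal variable of \<open>\<phi>\<close>, so its Skolem functions are constant,
  as if it were free. For \<open>\<forall>v: \<phi>\<close>, the functions \<open>s0\<close> and \<open>s1\<close> are the cofactors of \<open>t\<close> at \<open>v = 0\<close> and
  \<open>v = 1\<close>, and the third condition on \<open>t\<close> is Shannon's expansion.
\<close>

section \<open>Boolean functions, their supports and constants\<close>

lemma bfunsD: "f \<in> bfuns W \<Longrightarrow> (\<And>w. w \<in> W \<Longrightarrow> a w = b w) \<Longrightarrow> f a = f b"
  by (auto simp: bfuns_def)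

lemma const_in_bfuns [simp]: "(\<lambda>_. c) \<in> bfuns W"
  by (simp add: bfuns_def)

lemma supp_const [simp]: "supp (\<lambda>_. c) = {}"
  by (simp add: supp_def)

lemma bconst_iff: "f \<in> {bzero, bone} \<longleftrightarrow> (\<exists>c. f = (\<lambda>_. c))"
proof -
  have "(\<lambda>_. c) \<in> {bzero, bone}" for c
    by (cases c) (auto simp: bzero_def bone_def)
  then show ?thesis by (auto simp: bzero_def bone_def)
qed

lemma eq_if_not_in_supp:
  assumes "v \<notin> supp f"
  shows "f (a(v := c)) = f a"
proof -
  have "f (a(v := True)) = f (a(v := False))" using assms by (auto simp: supp_def)
  \<comment> \<open>One of the two updates is \<open>a\<close> itself, the one that writes the value
    \<open>a v\<close>.\<close>
  then show ?thesis by (metis (full_types) fun_upd_triv)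
qed

text \<open>\<open>supp\<close> only speaks about changing one variable at a time. Finiteness of
  \<open>W'\<close> lets finitely many such changes turn one assignment into another; the function
  "infinitely many variables are true" has empty support without being constant.\<close>

lemma bfuns_supp:
  assumes "finite W'" "f \<in> bfuns W'" "supp f \<subseteq> W"
  shows "f \<in> bfuns W"
proof -
  have *: "f (\<lambda>w. if w \<in> U then b w else a w) = f a"
    if "finite U" "U \<inter> supp f = {}" for U a b
    using that
  proof induction
    case (insert u U)
    have "(\<lambda>w. if w \<in> insert u U then b w else a w) = (\<lambda>w. if w \<in> U then b w else a w)(u := b u)"
      by (simp add: fun_eq_iff)
    then show ?case using insert by (simp add: eq_if_not_in_supp)
  qed simp
  have "f a = f b" if ab: "\<forall>w\<in>W. a w = b w" for a b
  proof -
    \<comment> \<open>The hybrid differs from \<open>a\<close> only off the support, and it agrees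
      with \<open>b\<close> on all of \<open>W'\<close>: by construction on \<open>W' - W\<close>,
      by assumption on \<open>W\<close>.\<close>
    have "f a = f (\<lambda>w. if w \<in> W' - W then b w else a w)"
      using assms by (intro *[symmetric]) auto
    also have "\<dots> = f b"
      by (rule bfunsD[OF assms(2)]) (use ab in auto)
    finally show ?thesis .
  qed
  then show ?thesis by (simp add: bfuns_def)
qed

text \<open>Links the two clauses of \<open>cand\<close>: the one for free variables asks for a
  constant, the one for existential variables bounds the support.\<close>

lemma bconst_iff_supp:
  assumes "finite W" "f \<in> bfuns W"
  shows "f \<in> {bzero, bone} \<longleftrightarrow> supp f = {}"
proof
  assume "supp f = {}"
  then have "f \<in> bfuns {}" using bfuns_supp[OF assms] by simp
  then have "f = (\<lambda>_. f (\<lambda>_. False))" by (auto simp: bfuns_def)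
  then show "f \<in> {bzero, bone}" unfolding bconst_iff by blast
qed (auto simp: bzero_def bone_def)

section \<open>Skolem function candidates\<close>

lemma dep_eq_empty: "y \<notin> Vex \<phi> \<Longrightarrow> dep \<phi> y = {}"
  by (induction \<phi>) auto

text \<open>Replaces the total selector \<open>the\<close> in \<open>cand\<close> by explicit
  values, so that undefinedness at universal variables remains visible.\<close>

lemma candD:
  assumes "s \<in> cand V \<phi>"
  shows cand_dom: "dom s = Vfree V \<phi> \<union> Vex \<phi>"
    and cand_bfuns: "s w = Some f \<Longrightarrow> f \<in> bfuns (Vall \<phi>)"
    and cand_free: "w \<in> Vfree V \<phi> \<Longrightarrow> \<exists>c. s w = Some (\<lambda>_. c)"
    and cand_ex: "w \<in> Vex \<phi> \<Longrightarrow> \<exists>f. s w = Some f \<and> supp f \<subseteq> dep \<phi> w \<inter> Vall \<phi>"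
proof -
  show dom: "dom s = Vfree V \<phi> \<union> Vex \<phi>" using assms by (simp add: cand_def)
  show "s w = Some f \<Longrightarrow> f \<in> bfuns (Vall \<phi>)" using assms by (auto simp: cand_def ran_def)
  show "\<exists>c. s w = Some (\<lambda>_. c)" if w: "w \<in> Vfree V \<phi>"
  proof -
    obtain f where f: "s w = Some f" using w dom by auto
    have "the (s w) \<in> {bzero, bone}" using w assms unfolding cand_def by blast
    then show ?thesis using f unfolding bconst_iff by auto
  qed
  show "\<exists>f. s w = Some f \<and> supp f \<subseteq> dep \<phi> w \<inter> Vall \<phi>" if w: "w \<in> Vex \<phi>"
  proof -
    obtain f where f: "s w = Some f" using w dom by auto
    have "supp (the (s w)) \<subseteq> dep \<phi> w \<inter> Vall \<phi>" using w assms unfolding cand_def by blast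
    then show ?thesis using f by auto
  qed
qed

text \<open>Membership in \<open>bfuns\<close> is demanded only at existential variables, because
  constants lie in every \<open>bfuns W\<close>.\<close>

lemma candI:
  assumes "dom s = Vfree V \<phi> \<union> Vex \<phi>"
    and "\<And>w. w \<in> Vfree V \<phi> \<Longrightarrow> \<exists>c. s w = Some (\<lambda>_. c)"
    and "\<And>w. w \<in> Vex \<phi> \<Longrightarrow> \<exists>f \<in> bfuns (Vall \<phi>). s w = Some f \<and> supp f \<subseteq> dep \<phi> w \<inter> Vall \<phi>"
  shows "s \<in> cand V \<phi>"
proof -
  have "f \<in> bfuns (Vall \<phi>)" if f: "s w = Some f" for w f
  proof -
    have "w \<in> Vfree V \<phi> \<or> w \<in> Vex \<phi>" using f assms(1) by auto
    then show ?thesis using assms(2,3)[of w] f by auto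
  qed
  moreover have "the (s w) \<in> {bzero, bone}" if "w \<in> Vfree V \<phi>" for w
    using assms(2)[OF that] unfolding bconst_iff by auto
  moreover have "supp (the (s w)) \<subseteq> dep \<phi> w \<inter> Vall \<phi>" if "w \<in> Vex \<phi>" for w
    using assms(3)[OF that] by auto
  ultimately show ?thesis using assms(1) unfolding cand_def ran_def by blast
qed

text \<open>The case split for uses of \<open>subst_cong\<close>. In a well-formed formula
  \<open>Vex \<phi>\<close> and \<open>Vall \<phi>\<close> are disjoint, so universal variables lie
  outside \<open>dom s\<close> and survive substitution as variables.\<close>

lemma DQBF_var_cases:
  assumes "\<phi> \<in> DQBF V" "s \<in> cand V \<phi>" "w \<in> Vfs \<phi> \<union> VQ \<phi>"
  obtains (all) "w \<in> Vall \<phi>" "s w = None"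
    | (free) "w \<in> Vfree V \<phi>"
    | (ex) "w \<in> Vex \<phi>"
proof -
  note vars = DQBF_vars[OF assms(1)]
  have "w \<in> Vall \<phi> \<Longrightarrow> s w = None"
    using vars cand_dom[OF assms(2)] unfolding Vfree_def VQ_def by blast
  moreover have "w \<in> Vall \<phi> \<or> w \<in> Vfree V \<phi> \<or> w \<in> Vex \<phi>"
    using vars assms(3) by (auto simp: Vfree_def VQ_def)
  ultimately show thesis using that by blast
qed

text \<open>After substitution only universal variables are left, next to constants and functions of
  \<open>Vall \<phi>\<close>.\<close>

lemma qf_val_subst_universal:
  assumes "\<phi> \<in> DQBF V" "s \<in> cand V \<phi>" "\<And>w. w \<in> Vall \<phi> \<Longrightarrow> a w = b w"
  shows "qf_val (subst s \<phi>) a = qf_val (subst s \<phi>) b"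
proof (rule subst_cong)
  fix w assume "w \<in> Vfs \<phi> \<union> VQ \<phi>"
  with assms(1,2) show "qf_val (subst_var s w) a = qf_val (subst_var s w) b"
  proof (cases rule: DQBF_var_cases)
    case all
    then show ?thesis by (simp add: subst_var_def assms(3))
  next
    case free
    then obtain c where "s w = Some (\<lambda>_. c)" using cand_free[OF assms(2)] by blast
    then show ?thesis by (simp add: subst_var_def)
  next
    case ex
    then obtain f where f: "s w = Some f" using cand_ex[OF assms(2)] by blast
    have "f a = f b" by (rule bfunsD[OF cand_bfuns[OF assms(2) f] assms(3)])
    then show ?thesis by (simp add: f subst_var_def)
  qed
qed

section \<open>Restricting candidates of a binary connective to its components\<close>

lemma cand_Disj: "cand V (Disj \<phi>1 \<phi>2) = cand V (Conj \<phi>1 \<phi>2)"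
  by (simp add: cand_def Vfree_def VQ_def)

lemma cand_Conj_commute: "cand V (Conj \<phi>2 \<phi>1) = cand V (Conj \<phi>1 \<phi>2)"
  by (simp add: cand_def Vfree_def VQ_def Un_ac)

lemma compatible_commute: "compatible \<phi>2 \<phi>1 \<longleftrightarrow> compatible \<phi>1 \<phi>2"
  by (auto simp: compatible_def)

text \<open>A priori an existential variable of \<open>\<phi>1\<close> may receive a function that
  also reads \<open>Vall \<phi>2\<close>; compatibility keeps its dependency set away from
  \<open>VQ \<phi>2\<close>. The second component and disjunctions follow through the symmetry of
  \<open>compatible\<close> and \<open>cand\<close> and through \<open>cand_Disj\<close>.\<close>

lemma Conj_restrict:
  fixes V :: "'v set"
  assumes fin: "finite V" and \<phi>: "\<phi>1 \<in> DQBF V" "\<phi>2 \<in> DQBF V" and comp: "compatible \<phi>1 \<phi>2"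
    and s: "s \<in> cand V (Conj \<phi>1 \<phi>2)"
  defines "r \<equiv> s |` (Vfree (V - VQ \<phi>2) \<phi>1 \<union> Vex \<phi>1)"
  shows "r \<in> cand (V - VQ \<phi>2) \<phi>1" (is ?cand)
    and "qf_val (subst s \<phi>1) a = qf_val (subst r \<phi>1) a" (is ?val)
    and "(\<And>w. w \<in> Vall \<phi>1 \<Longrightarrow> a w = b w) \<Longrightarrow> qf_val (subst s \<phi>1) a = qf_val (subst s \<phi>1) b"
      (is "PROP ?indep")
proof -
  note vars = DQBF_vars[OF \<phi>(1)] DQBF_vars[OF \<phi>(2)]
  have disj: "(VQ \<phi>1 \<union> Vfs \<phi>1 \<union> (\<Union>y\<in>Vex \<phi>1. dep \<phi>1 y)) \<inter> VQ \<phi>2 = {}"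
    using comp by (simp add: compatible_def)
  \<comment> \<open>Free in the conjunction over \<open>V\<close> means the same as free in
    \<open>\<phi>1\<close> over \<open>V - VQ \<phi>2\<close>, so the restriction drops at most
    \<open>Vex \<phi>2\<close>.\<close>
  have doms: "dom s = Vfree (V - VQ \<phi>2) \<phi>1 \<union> Vex \<phi>1 \<union> Vex \<phi>2"
    using cand_dom[OF s] by (auto simp: Vfree_def VQ_def)
  show cand: ?cand
  proof (rule candI)
    show "dom r = Vfree (V - VQ \<phi>2) \<phi>1 \<union> Vex \<phi>1"
      unfolding r_def dom_restrict doms by auto
    show "\<exists>c. r w = Some (\<lambda>_. c)" if "w \<in> Vfree (V - VQ \<phi>2) \<phi>1" for w
      using cand_free[OF s, of w] that by (auto simp: r_def Vfree_def VQ_def)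
    show "\<exists>f\<in>bfuns (Vall \<phi>1). r w = Some f \<and> supp f \<subseteq> dep \<phi>1 w \<inter> Vall \<phi>1" if w: "w \<in> Vex \<phi>1" for w
    proof -
      obtain f where f: "s w = Some f" "supp f \<subseteq> dep (Conj \<phi>1 \<phi>2) w \<inter> Vall (Conj \<phi>1 \<phi>2)"
        using cand_ex[OF s, of w] w by auto
      \<comment> \<open>Hence \<open>dep \<phi>2 w\<close> is empty, and the dependency set of
        \<open>w\<close> in the conjunction is just \<open>dep \<phi>1 w\<close>, which avoids
        \<open>Vall \<phi>2\<close>.\<close>
      have "w \<notin> Vex \<phi>2" using w disj by (auto simp: VQ_def)
      then have supp: "supp f \<subseteq> dep \<phi>1 w \<inter> Vall \<phi>1"
        using f(2) w disj by (auto simp: dep_eq_empty VQ_def)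
      have "finite (Vall (Conj \<phi>1 \<phi>2))"
        using vars fin by (auto simp: VQ_def intro: finite_subset)
      then have "f \<in> bfuns (Vall \<phi>1)"
        using bfuns_supp[OF _ cand_bfuns[OF s f(1)]] supp by blast
      then show ?thesis using supp f(1) w by (simp add: r_def)
    qed
  qed
  have eq: "qf_val (subst s \<phi>1) c = qf_val (subst r \<phi>1) c" for c
  proof (rule subst_cong)
    fix w assume w: "w \<in> Vfs \<phi>1 \<union> VQ \<phi>1"
    then have "w \<notin> Vex \<phi>2" using disj by (auto simp: VQ_def)
    then have "r w = s w" using doms by (auto simp: r_def restrict_map_def)
    then show "qf_val (subst_var s w) c = qf_val (subst_var r w) c" by (simp add: subst_var_def)
  qed
  then show ?val .
  \<comment> \<open>\<open>\<phi>1\<close> is also a formula over the smaller ambient set, where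
    \<open>r\<close> is a candidate; \<open>eq\<close> carries the result back to
    \<open>s\<close>.\<close>
  show "PROP ?indep"
    using qf_val_subst_universal[OF DQBF_ambient[OF \<phi>(1) disj] cand] unfolding eq .
qed

lemma DQBF_ConjD:
  assumes "Conj \<phi>1 \<phi>2 \<in> DQBF V"
  shows "\<phi>1 \<in> DQBF V" "\<phi>2 \<in> DQBF V" "compatible \<phi>1 \<phi>2"
  using assms by (auto elim: DQBF.cases)

lemma DQBF_DisjD:
  assumes "Disj \<phi>1 \<phi>2 \<in> DQBF V"
  shows "\<phi>1 \<in> DQBF V" "\<phi>2 \<in> DQBF V" "compatible \<phi>1 \<phi>2"
  using assms by (auto elim: DQBF.cases)

lemma DQBF_ForallD:
  assumes "Forall v \<phi> \<in> DQBF V"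
  shows "\<phi> \<in> DQBF V" "v \<in> Vfree V \<phi>"
  using assms by (auto elim: DQBF.cases)

section \<open>Literals and binary connectives\<close>

lemma sem_Pos:
  assumes "v \<in> V"
  shows "sem V (Pos v) = {s \<in> cand V (Pos v). s v = Some bone}"
proof -
  \<comment> \<open>As \<open>v\<close> is free in the literal, \<open>s v\<close> is a constant,
    and the only valid constant is \<open>bone\<close>.\<close>
  have "tautology (subst s (Pos v)) \<longleftrightarrow> s v = Some bone" if "s \<in> cand V (Pos v)" for s
    using cand_free[OF that, of v] assms
    by (auto simp: Vfree_def VQ_def tautology_def subst_var_def bone_def fun_eq_iff)
  then show ?thesis by (auto simp: sem_def)
qed

lemma sem_Neg:
  assumes "v \<in> V"
  shows "sem V (Neg v) = {s \<in> cand V (Neg v). s v = Some bzero}"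
proof -
  have "tautology (subst s (Neg v)) \<longleftrightarrow> s v = Some bzero" if "s \<in> cand V (Neg v)" for s
    using cand_free[OF that, of v] assms
    by (auto simp: Vfree_def VQ_def tautology_def subst_var_def bzero_def fun_eq_iff)
  then show ?thesis by (auto simp: sem_def)
qed

text \<open>Removes restriction and change of ambient set, leaving for both connectives only a
  question about validity of \<open>subst s \<phi>1\<close> and
  \<open>subst s \<phi>2\<close>.\<close>

lemma sem_restrict_iff:
  assumes "finite V" "\<phi>1 \<in> DQBF V" "\<phi>2 \<in> DQBF V" "compatible \<phi>1 \<phi>2" "s \<in> cand V (Conj \<phi>1 \<phi>2)"
  shows "s |` (Vfree (V - VQ \<phi>2) \<phi>1 \<union> Vex \<phi>1) \<in> sem (V - VQ \<phi>2) \<phi>1 \<longleftrightarrow> tautology (subst s \<phi>1)"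
    and "s |` (Vfree (V - VQ \<phi>1) \<phi>2 \<union> Vex \<phi>2) \<in> sem (V - VQ \<phi>1) \<phi>2 \<longleftrightarrow> tautology (subst s \<phi>2)"
proof -
  have "s \<in> cand V (Conj \<phi>2 \<phi>1)" "compatible \<phi>2 \<phi>1"
    using assms by (simp_all add: cand_Conj_commute compatible_commute)
  then show "s |` (Vfree (V - VQ \<phi>2) \<phi>1 \<union> Vex \<phi>1) \<in> sem (V - VQ \<phi>2) \<phi>1 \<longleftrightarrow> tautology (subst s \<phi>1)"
    and "s |` (Vfree (V - VQ \<phi>1) \<phi>2 \<union> Vex \<phi>2) \<in> sem (V - VQ \<phi>1) \<phi>2 \<longleftrightarrow> tautology (subst s \<phi>2)"
    using Conj_restrict(1,2)[OF assms(1,2,3)] Conj_restrict(1,2)[OF assms(1,3,2)] assms(4,5)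
    by (simp_all add: sem_def tautology_def)
qed

lemma sem_Conj:
  assumes "finite V" "Conj \<phi>1 \<phi>2 \<in> DQBF V"
  shows "sem V (Conj \<phi>1 \<phi>2) = {s \<in> cand V (Conj \<phi>1 \<phi>2).
    s |` (Vfree (V - VQ \<phi>2) \<phi>1 \<union> Vex \<phi>1) \<in> sem (V - VQ \<phi>2) \<phi>1 \<and>
    s |` (Vfree (V - VQ \<phi>1) \<phi>2 \<union> Vex \<phi>2) \<in> sem (V - VQ \<phi>1) \<phi>2}"
proof -
  have "tautology (subst s (Conj \<phi>1 \<phi>2)) \<longleftrightarrow>
      tautology (subst s \<phi>1) \<and> tautology (subst s \<phi>2)" for s
    by (auto simp: tautology_def)
  then show ?thesis
    unfolding sem_def[of V "Conj \<phi>1 \<phi>2"]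
    using sem_restrict_iff[OF assms(1) DQBF_ConjD[OF assms(2)]] by auto
qed

lemma sem_Disj:
  assumes "finite V" "Disj \<phi>1 \<phi>2 \<in> DQBF V"
  shows "sem V (Disj \<phi>1 \<phi>2) = {s \<in> cand V (Disj \<phi>1 \<phi>2).
    s |` (Vfree (V - VQ \<phi>2) \<phi>1 \<union> Vex \<phi>1) \<in> sem (V - VQ \<phi>2) \<phi>1 \<or>
    s |` (Vfree (V - VQ \<phi>1) \<phi>2 \<union> Vex \<phi>2) \<in> sem (V - VQ \<phi>1) \<phi>2}"
proof -
  note \<phi> = DQBF_DisjD[OF assms(2)]
  have "tautology (subst s (Disj \<phi>1 \<phi>2)) \<longleftrightarrow>
      tautology (subst s \<phi>1) \<or> tautology (subst s \<phi>2)" if s: "s \<in> cand V (Conj \<phi>1 \<phi>2)" for s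
  proof
    assume taut: "tautology (subst s (Disj \<phi>1 \<phi>2))"
    show "tautology (subst s \<phi>1) \<or> tautology (subst s \<phi>2)"
    proof (rule ccontr)
      assume "\<not> ?thesis"
      then obtain a1 a2 where a: "\<not> qf_val (subst s \<phi>1) a1" "\<not> qf_val (subst s \<phi>2) a2"
        by (auto simp: tautology_def)
      \<comment> \<open>\<open>Vall \<phi>2\<close> is disjoint from \<open>Vall \<phi>1\<close>, so
        the default branch makes \<open>a\<close> agree with \<open>a2\<close> on it, and
        \<open>a\<close> falsifies both disjuncts.\<close>
      define a where "a w = (if w \<in> Vall \<phi>1 then a1 w else a2 w)" for w
      have "qf_val (subst s \<phi>1) a = qf_val (subst s \<phi>1) a1"
        by (rule Conj_restrict(3)[OF assms(1) \<phi> s]) (simp add: a_def)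
      moreover have "qf_val (subst s \<phi>2) a = qf_val (subst s \<phi>2) a2"
      proof (rule Conj_restrict(3)[OF assms(1) \<phi>(2,1)])
        show "compatible \<phi>2 \<phi>1" "s \<in> cand V (Conj \<phi>2 \<phi>1)"
          using \<phi> s by (simp_all add: cand_Conj_commute compatible_commute)
        show "a w = a2 w" if "w \<in> Vall \<phi>2" for w
          using that \<phi>(3) by (auto simp: a_def compatible_def VQ_def)
      qed
      moreover have "qf_val (subst s (Disj \<phi>1 \<phi>2)) a"
        using taut by (simp only: tautology_def)
      ultimately show False using a by simp
    qed
  qed (auto simp: tautology_def)
  then show ?thesis
    unfolding sem_def[of V "Disj \<phi>1 \<phi>2"] cand_Disj
    using sem_restrict_iff[OF assms(1) \<phi>] by auto
qed

section \<open>Existential quantification\<close>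

lemma cand_Exists:
  fixes \<phi> :: "'v dqbf"
  assumes fin: "finite (Vall \<phi>)" and v: "v \<in> Vfree V \<phi>" and D: "D \<inter> Vall \<phi> = {}"
  shows "cand V (Exists v D \<phi>) = cand V \<phi>"
proof -
  have free: "Vfree V (Exists v D \<phi>) = Vfree V \<phi> - {v}" by (auto simp: Vfree_def VQ_def)
  have vars: "Vfree V \<phi> - {v} \<union> Vex (Exists v D \<phi>) = Vfree V \<phi> \<union> Vex \<phi>"
    using v by auto
  have "v \<notin> Vex \<phi>" using v by (auto simp: Vfree_def VQ_def)
  \<comment> \<open>At \<open>v\<close> the bound on the support is
    \<open>D \<inter> Vall \<phi>\<close>, which is empty.\<close>
  then have ex: "(\<forall>w\<in>Vex (Exists v D \<phi>). supp (the (s w)) \<subseteq> dep (Exists v D \<phi>) w \<inter> Vall \<phi>)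
      \<longleftrightarrow> supp (the (s v)) = {} \<and> (\<forall>w\<in>Vex \<phi>. supp (the (s w)) \<subseteq> dep \<phi> w \<inter> Vall \<phi>)"
    for s :: "'v skolem"
    using D by auto
  have all: "(\<forall>w\<in>Vfree V \<phi>. P w) \<longleftrightarrow> P v \<and> (\<forall>w\<in>Vfree V \<phi> - {v}. P w)" for P
    using v by blast
  have "s \<in> cand V (Exists v D \<phi>) \<longleftrightarrow> s \<in> cand V \<phi>" for s
  \<comment> \<open>Domain and range conditions coincide on both sides. Once they hold,
    \<open>s v\<close> is a function of finitely many variables, so being constant and having empty
    support can be exchanged.\<close>
  proof (cases "dom s = Vfree V \<phi> \<union> Vex \<phi> \<and> ran s \<subseteq> bfuns (Vall \<phi>)")
    case True
    then have "v \<in> dom s" using v by blast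
    then obtain f where "s v = Some f" by blast
    then have "the (s v) \<in> bfuns (Vall \<phi>)" using True by (auto simp: ran_def)
    then have "the (s v) \<in> {bzero, bone} \<longleftrightarrow> supp (the (s v)) = {}"
      by (rule bconst_iff_supp[OF fin])
    then show ?thesis
      unfolding cand_def mem_Collect_eq Vall.simps ex free vars
      using all[of "\<lambda>w. the (s w) \<in> {bzero, bone}"] True by argo
  next
    case False
    then show ?thesis unfolding cand_def mem_Collect_eq Vall.simps free vars by argo
  qed
  then show ?thesis by blast
qed

text \<open>Substitution erases quantifiers, so equal candidate sets suffice. The body is kept
  arbitrary in order to be instantiated with \<open>del_dep v \<phi>\<close>.\<close>

lemma sem_Exists:
  assumes "finite (Vall \<phi>)" "v \<in> Vfree V \<phi>" "D \<inter> Vall \<phi> = {}"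
  shows "sem V (Exists v D \<phi>) = sem V \<phi>"
  using cand_Exists[OF assms] by (simp add: sem_def)

section \<open>Cofactors and universal quantification\<close>

definition cofactor :: "'v \<Rightarrow> bool \<Rightarrow> 'v bfun \<Rightarrow> 'v bfun" where
  "cofactor v c f = (\<lambda>a. f (a(v := c)))"

lemma cofactor_const [simp]: "cofactor v c (\<lambda>_. d) = (\<lambda>_. d)"
  by (simp add: cofactor_def)

lemma cofactor_in_bfuns: "f \<in> bfuns (insert v W) \<Longrightarrow> cofactor v c f \<in> bfuns W"
  by (auto simp: bfuns_def cofactor_def)

lemma supp_cofactor: "supp (cofactor v c f) \<subseteq> supp f - {v}"
proof
  fix x assume "x \<in> supp (cofactor v c f)"
  then obtain a where a: "f (a(x := True, v := c)) \<noteq> f (a(x := False, v := c))"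
    by (auto simp: supp_def cofactor_def)
  \<comment> \<open>For \<open>x = v\<close> the later update would overwrite the earlier one and
    both values would coincide.\<close>
  then have "x \<noteq> v" by auto
  then have "f ((a(v := c))(x := True)) \<noteq> f ((a(v := c))(x := False))"
    using a by (simp add: fun_upd_twist)
  then have "x \<in> supp f" unfolding supp_def by blast
  then show "x \<in> supp f - {v}" using \<open>x \<noteq> v\<close> by simp
qed

lemma cofactor_eq: "v \<notin> supp f \<Longrightarrow> cofactor v c f = f"
  by (simp add: cofactor_def eq_if_not_in_supp)

lemma ITE_cofactor: "ITE (bvar v) (cofactor v True f) (cofactor v False f) = f"
proof
  fix a
  \<comment> \<open>The branch selected by \<open>a v\<close> evaluates \<open>f\<close> at
    \<open>a(v := a v)\<close>.\<close>
  have "f (a(v := a v)) = f a" by simp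
  then show "ITE (bvar v) (cofactor v True f) (cofactor v False f) a = f a"
    by (cases "a v") (simp_all add: ITE_def bvar_def cofactor_def del: fun_upd_triv)
qed

text \<open>Below the quantifier \<open>v\<close> becomes free and needs a constant, hence the added
  entry; taking cofactors leaves the constants at the other free variables unchanged.\<close>

definition skolem_cofactor :: "'v \<Rightarrow> bool \<Rightarrow> 'v skolem \<Rightarrow> 'v skolem" where
  "skolem_cofactor v c t = (map_option (cofactor v c) \<circ> t)(v \<mapsto> (\<lambda>_. c))"

lemma skolem_cofactor_in_sem:
  assumes \<phi>: "\<phi> \<in> DQBF V" "v \<in> Vfree V \<phi>" and t: "t \<in> sem V (Forall v \<phi>)"
  shows "skolem_cofactor v c t \<in> sem V \<phi>"
proof -
  let ?s = "skolem_cofactor v c t"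
  have cand: "t \<in> cand V (Forall v \<phi>)" using t by (simp add: sem_def)
  have free: "Vfree V (Forall v \<phi>) = Vfree V \<phi> - {v}" by (auto simp: Vfree_def VQ_def)
  have v: "v \<notin> Vex \<phi>" "v \<notin> Vall \<phi>" using \<phi>(2) by (auto simp: Vfree_def VQ_def)
  have tv: "t v = None" using cand_dom[OF cand] v by (auto simp: free)
  have "dom ?s = insert v (dom t)" by (auto simp: skolem_cofactor_def split: if_splits)
  also have "\<dots> = Vfree V \<phi> \<union> Vex \<phi>" using cand_dom[OF cand] \<phi>(2) by (auto simp: free)
  finally have dom: "dom ?s = Vfree V \<phi> \<union> Vex \<phi>" .
  have s_cand: "?s \<in> cand V \<phi>"
  proof (rule candI[OF dom])
    show "\<exists>d. ?s w = Some (\<lambda>_. d)" if w: "w \<in> Vfree V \<phi>" for w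
    proof (cases "w = v")
      case True
      then show ?thesis by (auto simp: skolem_cofactor_def)
    next
      case False
      then obtain d where "t w = Some (\<lambda>_. d)" using cand_free[OF cand, of w] w free by auto
      then have "?s w = Some (\<lambda>_. d)" using False by (simp add: skolem_cofactor_def)
      then show ?thesis by blast
    qed
    show "\<exists>f\<in>bfuns (Vall \<phi>). ?s w = Some f \<and> supp f \<subseteq> dep \<phi> w \<inter> Vall \<phi>" if w: "w \<in> Vex \<phi>" for w
    proof -
      obtain f where f: "t w = Some f" "supp f \<subseteq> dep \<phi> w \<inter> insert v (Vall \<phi>)"
        using cand_ex[OF cand, of w] w by auto
      have "cofactor v c f \<in> bfuns (Vall \<phi>)"
        using cand_bfuns[OF cand f(1)] by (intro cofactor_in_bfuns) simp
      moreover have "supp (cofactor v c f) \<subseteq> dep \<phi> w \<inter> Vall \<phi>"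
        using supp_cofactor[of v c f] f(2) by blast
      moreover have "?s w = Some (cofactor v c f)"
        using w v f(1) by (auto simp: skolem_cofactor_def)
      ultimately show ?thesis by blast
    qed
  qed
  \<comment> \<open>Fixing \<open>v\<close> in the functions amounts to fixing it in the assignment:
    the entry at \<open>v\<close> has value \<open>c\<close>, and a variable undefined in
    \<open>?s\<close> differs from \<open>v\<close>, so the update does not affect it.\<close>
  have "qf_val (subst ?s \<phi>) a = qf_val (subst t \<phi>) (a(v := c))" for a
    by (rule subst_cong)
      (auto simp: skolem_cofactor_def subst_var_def tv cofactor_def split: option.splits)
  then have "tautology (subst ?s \<phi>)" using t by (simp add: sem_def tautology_def)
  then show ?thesis using s_cand by (simp add: sem_def)
qed

lemma sem_Forall:
  assumes "Forall v \<phi> \<in> DQBF V"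
  shows "sem V (Forall v \<phi>) = {t \<in> cand V (Forall v \<phi>).
    \<exists>s0\<in>sem V \<phi>. \<exists>s1\<in>sem V \<phi>. s0 v = Some bzero \<and> s1 v = Some bone \<and>
      (\<forall>w\<in>Vfree V (Forall v \<phi>). t w = s0 w \<and> s0 w = s1 w) \<and>
      (\<forall>w\<in>Vex (Forall v \<phi>). v \<notin> dep (Forall v \<phi>) w \<longrightarrow> t w = s0 w \<and> s0 w = s1 w) \<and>
      (\<forall>w\<in>Vex (Forall v \<phi>). v \<in> dep (Forall v \<phi>) w \<longrightarrow>
         t w = Some (ITE (bvar v) (the (s1 w)) (the (s0 w))))}"
    (is "_ = {t \<in> _. \<exists>s0\<in>_. \<exists>s1\<in>_. ?R t s0 s1}")
proof (intro equalityI subsetI)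
  note \<phi> = DQBF_ForallD[OF assms]
  have v: "v \<notin> Vex \<phi>" "v \<notin> Vall \<phi>" using \<phi>(2) by (auto simp: Vfree_def VQ_def)
  fix t assume t: "t \<in> sem V (Forall v \<phi>)"
  then have cand: "t \<in> cand V (Forall v \<phi>)" by (simp add: sem_def)
  have "?R t (skolem_cofactor v False t) (skolem_cofactor v True t)"
  proof (intro conjI ballI impI)
    fix w assume w: "w \<in> Vfree V (Forall v \<phi>)"
    then have "w \<noteq> v" by (auto simp: Vfree_def VQ_def)
    then have "skolem_cofactor v c t w = t w" for c
      using cand_free[OF cand w] by (auto simp: skolem_cofactor_def)
    then show "t w = skolem_cofactor v False t w"
      "skolem_cofactor v False t w = skolem_cofactor v True t w" by simp_all
  next
    fix w assume w: "w \<in> Vex (Forall v \<phi>)" and dep: "v \<notin> dep (Forall v \<phi>) w"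
    obtain f where f: "t w = Some f" "supp f \<subseteq> dep (Forall v \<phi>) w"
      using cand_ex[OF cand w] by blast
    have "cofactor v c f = f" for c using dep f(2) by (intro cofactor_eq) blast
    then have "skolem_cofactor v c t w = t w" for c
      using w v f(1) by (auto simp: skolem_cofactor_def)
    then show "t w = skolem_cofactor v False t w"
      "skolem_cofactor v False t w = skolem_cofactor v True t w" by simp_all
  next
    fix w assume w: "w \<in> Vex (Forall v \<phi>)"
    then show "t w = Some (ITE (bvar v) (the (skolem_cofactor v True t w))
        (the (skolem_cofactor v False t w)))"
      using v cand_ex[OF cand w] by (auto simp: skolem_cofactor_def ITE_cofactor)
  qed (simp_all add: skolem_cofactor_def bzero_def bone_def)
  then show "t \<in> {t \<in> cand V (Forall v \<phi>). \<exists>s0\<in>sem V \<phi>. \<exists>s1\<in>sem V \<phi>. ?R t s0 s1}"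
    using cand skolem_cofactor_in_sem[OF \<phi> t] by blast
next
  note \<phi> = DQBF_ForallD[OF assms]
  fix t assume "t \<in> {t \<in> cand V (Forall v \<phi>). \<exists>s0\<in>sem V \<phi>. \<exists>s1\<in>sem V \<phi>. ?R t s0 s1}"
  then obtain s0 s1 where t: "t \<in> cand V (Forall v \<phi>)"
    and s: "s0 \<in> sem V \<phi>" "s1 \<in> sem V \<phi>" and R: "?R t s0 s1" by blast
  have free: "Vfree V (Forall v \<phi>) = Vfree V \<phi> - {v}" by (auto simp: Vfree_def VQ_def)
  have v: "v \<notin> Vex \<phi>" "v \<notin> Vall \<phi>" using \<phi>(2) by (auto simp: Vfree_def VQ_def)
  have "qf_val (subst t \<phi>) a" for a
  proof -
    \<comment> \<open>The choice depends on \<open>a\<close>: of the two Skolem functions,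
      \<open>r\<close> is the one whose constant at \<open>v\<close> equals \<open>a v\<close>. At
      \<open>a\<close>, and in general only there, \<open>t\<close> and \<open>r\<close> give the
      same values.\<close>
    define r where "r = (if a v then s1 else s0)"
    have r: "r \<in> sem V \<phi>" using s by (simp add: r_def)
    then have r_cand: "r \<in> cand V \<phi>" by (simp add: sem_def)
    have "qf_val (subst t \<phi>) a = qf_val (subst r \<phi>) a"
    proof (rule subst_cong)
      fix w assume "w \<in> Vfs \<phi> \<union> VQ \<phi>"
      with \<phi>(1) r_cand show "qf_val (subst_var t w) a = qf_val (subst_var r w) a"
      proof (cases rule: DQBF_var_cases)
        case all
        then have "w \<notin> dom t"
          using cand_dom[OF t] DQBF_vars(3)[OF \<phi>(1)] by (auto simp: Vfree_def VQ_def)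
        then show ?thesis using all by (simp add: subst_var_def domIff)
      next
        case w: free
        show ?thesis
        proof (cases "w = v")
          case True
          \<comment> \<open>Under \<open>t\<close> the variable \<open>v\<close> stays in the
            formula and evaluates to \<open>a v\<close>.\<close>
          then have "t w = None" using cand_dom[OF t] v by (auto simp: free)
          then show ?thesis using R True by (simp add: subst_var_def r_def bzero_def bone_def)
        next
          case False
          then show ?thesis using R w by (simp add: free subst_var_def r_def)
        qed
      next
        case ex
        have "s0 \<in> cand V \<phi>" "s1 \<in> cand V \<phi>" using s by (simp_all add: sem_def)
        \<comment> \<open>If \<open>w\<close> depends on \<open>v\<close>, the \<open>ITE\<close>
          evaluated at \<open>a\<close> selects the value of \<open>r\<close>; otherwise
          \<open>t\<close>, \<open>s0\<close> and \<open>s1\<close> agree at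
          \<open>w\<close>.\<close>
        then obtain f0 f1 where "s0 w = Some f0" "s1 w = Some f1" using ex cand_ex by metis
        then show ?thesis
          using R ex by (cases "v \<in> dep \<phi> w") (auto simp: subst_var_def r_def ITE_def bvar_def)
      qed
    qed
    then show ?thesis using r by (simp add: sem_def tautology_def)
  qed
  then have "tautology (subst t (Forall v \<phi>))" by (simp add: tautology_def)
  then show "t \<in> sem V (Forall v \<phi>)" using t by (simp add: sem_def)
qed

theorem theorem2:
  fixes V :: "'v set"
  assumes "finite V"
  shows
    "(\<forall>v\<in>V. sem V (Pos v) = {s \<in> cand V (Pos v). s v = Some bone}) \<and>
     (\<forall>v\<in>V. sem V (Neg v) = {s \<in> cand V (Neg v). s v = Some bzero}) \<and>
     (\<forall>\<phi>1 \<phi>2. Conj \<phi>1 \<phi>2 \<in> DQBF V \<longrightarrow>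
        sem V (Conj \<phi>1 \<phi>2) = {s \<in> cand V (Conj \<phi>1 \<phi>2).
          s |` (Vfree (V - VQ \<phi>2) \<phi>1 \<union> Vex \<phi>1) \<in> sem (V - VQ \<phi>2) \<phi>1 \<and>
          s |` (Vfree (V - VQ \<phi>1) \<phi>2 \<union> Vex \<phi>2) \<in> sem (V - VQ \<phi>1) \<phi>2}) \<and>
     (\<forall>\<phi>1 \<phi>2. Disj \<phi>1 \<phi>2 \<in> DQBF V \<longrightarrow>
        sem V (Disj \<phi>1 \<phi>2) = {s \<in> cand V (Disj \<phi>1 \<phi>2).
          s |` (Vfree (V - VQ \<phi>2) \<phi>1 \<union> Vex \<phi>1) \<in> sem (V - VQ \<phi>2) \<phi>1 \<or>
          s |` (Vfree (V - VQ \<phi>1) \<phi>2 \<union> Vex \<phi>2) \<in> sem (V - VQ \<phi>1) \<phi>2}) \<and>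
     (\<forall>\<phi> v D. \<phi> \<in> DQBF V \<and> v \<in> Vfree V \<phi> \<and> D \<subseteq> V - (VQ \<phi> \<union> {v}) \<longrightarrow>
        sem V (Exists v D (del_dep v \<phi>)) = sem V (del_dep v \<phi>)) \<and>
     (\<forall>\<phi> v. Forall v \<phi> \<in> DQBF V \<longrightarrow>
        sem V (Forall v \<phi>) = {t \<in> cand V (Forall v \<phi>).
          \<exists>s0\<in>sem V \<phi>. \<exists>s1\<in>sem V \<phi>. s0 v = Some bzero \<and> s1 v = Some bone \<and>
            (\<forall>w\<in>Vfree V (Forall v \<phi>). t w = s0 w \<and> s0 w = s1 w) \<and>
            (\<forall>w\<in>Vex (Forall v \<phi>). v \<notin> dep (Forall v \<phi>) w \<longrightarrow> t w = s0 w \<and> s0 w = s1 w) \<and>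
            (\<forall>w\<in>Vex (Forall v \<phi>). v \<in> dep (Forall v \<phi>) w \<longrightarrow>
               t w = Some (ITE (bvar v) (the (s1 w)) (the (s0 w))))})"
proof (intro conjI ballI allI impI, goal_cases)
  case (1 v)
  then show ?case by (rule sem_Pos)
next
  case (2 v)
  then show ?case by (rule sem_Neg)
next
  case (3 \<phi>1 \<phi>2)
  then show ?case by (rule sem_Conj[OF assms])
next
  case (4 \<phi>1 \<phi>2)
  then show ?case by (rule sem_Disj[OF assms])
next
  \<comment> \<open>\<open>del_dep\<close> preserves the quantified variables, so the conditions on
    \<open>\<phi>\<close> transfer to the body; \<open>D\<close> avoids \<open>VQ \<phi>\<close> and
    hence \<open>Vall \<phi>\<close>.\<close>
  case (5 \<phi> v D)
  then have "finite (Vall \<phi>)"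
    using assms DQBF_vars(1)[of \<phi> V] by (auto simp: VQ_def intro: finite_subset)
  with 5 show ?case
    by (intro sem_Exists) (auto simp: Vfree_def VQ_def)
next
  case (6 \<phi> v)
  then show ?case by (rule sem_Forall)
qed

end
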